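(* Let $n\ge3$ and $1\le k\le n-2$. Let $(1,c_1,\dots,c_{n-1})$, $c_i\in\mathrm{SU}(2)$, represent a point of $\Pi(n)$, and write the symmetric matrix of its spectral form as $$\begin{pmatrix} 1 & p_1 & p_2 & p_3 & \dots \\ p_1 & 1 & h_{12} & h_{13} & \dots \\ p_2 & h_{12} & 1 & h_{23} & \dots \\ p_3 & h_{13} & h_{23} & 1 & \dots \\ \vdots & \vdots & \vdots & \vdots & \ddots \end{pmatrix},\qquad h_{ij}=h_{ji}.$$ The generator $\sigma_k$ of the braid group $\mathrm{Br}_{n-1}$ acts by $c_k\mapsto c_kc_{k+1}c_k^{-1}$, $c_{k+1}\mapsto c_k$, with all other $c_i$ fixed. Let $\widetilde p_i,\widetilde h_{ij}$ be the entries of the matrix of the spectral form of the transformed tuple. Then $$\widetilde h_{ij}=h_{ij}\ \ (i,j\ne k,k+1),\qquad \widetilde p_i=p_i\ \ (i\ne k,k+1),\qquad \widetilde p_k=p_{k+1},\qquad \widetilde p_{k+1}=p_k,$$ and for $j\ne k,k+1$ $$\widetilde h_{(k+1)j}=h_{kj},$$ $$\widetilde h_{kj}=h_{(k+1)j}-2\det\begin{pmatrix} 1 & p_k & p_{k+1} \\ p_k & 1 & h_{k(k+1)} \\ p_j & h_{kj} & h_{(k+1)j} \end{pmatrix}-2p_k\cdot\det\begin{pmatrix} 1 & p_k & p_{k+1} & p_j \\ p_k & 1 & h_{k(k+1)} & h_{kj} \\ p_{k+1} & h_{k(k+1)} & 1 & h_{(k+1)j} \\ p_j & h_{kj} & h_{(k+1)j}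 & 1 \end{pmatrix}^{1/2}.$$ Here the square root $\det(\cdot)^{1/2}$ denotes the following branch: after a simultaneous conjugation making $c_k=\begin{pmatrix} e^{i\phi} & 0 \\ 0 & e^{-i\phi} \end{pmatrix}$ with $0\le\phi\le\pi$, let $b_i$ denote the upper right entry of $c_i$; the root is taken nonnegative if $\operatorname{Im}(b_{k+1}\overline{b_j})\ge0$ and nonpositive otherwise.
   Context: $\Pi(n)$ is the set of $n$-tuples in $\mathrm{SU}(2)$ modulo $(g_1,\dots,g_n)\sim(hg_1q,\dots,hg_nq)$, $h,q\in\mathrm{SU}(2)$; equivalently the set of tuples $(1,c_1,\dots,c_{n-1})$ modulo simultaneous conjugation. The spectral form of $(g_1,\dots,g_n)$ is the quadratic form $\det\bigl(\sum_j\lambda_jg_j\bigr)$ in real $\lambda_1,\dots,\lambda_n$; it depends only on the class in $\Pi(n)$ and has all diagonal coefficients equal to $1$. The braid group $\mathrm{Br}_{n-1}$ has generators $\sigma_1,\dots,\sigma_{n-2}$ and acts on $\Pi(n)$ via the Artin automorphisms of the free group on $c_1,\dots,c_{n-1}$ as described in the claim. *)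

theory Defs
  imports "HOL-Analysis.Analysis" "HOL-Algebra.Group_Action"
begin

section \<open>The space of tuples in SU(2)\<close>

definition adj :: "complex^2^2 \<Rightarrow> complex^2^2" where
  "adj A = (\<chi> i j. cnj (A $ j $ i))"

definition SU2 :: "(complex^2^2) set" where
  "SU2 = {A. adj A ** A = mat 1 \<and> det A = 1}"

text \<open>Tuples are indexed by \<open>0, \<dots>, n - 1\<close>, so that \<open>(1, c\<^sub>1, \<dots>, c\<^sub>n\<^sub>-\<^sub>1)\<close> is an
  extensional function \<open>c\<close> with \<open>c 0 = 1\<close> and \<open>c i = c\<^sub>i\<close>.\<close>

definition su2_tuples :: "nat \<Rightarrow> (nat \<Rightarrow> complex^2^2) set" where
  "su2_tuples n = ({..<n} \<rightarrow>\<^sub>E SU2)"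

definition pi_rel :: "nat \<Rightarrow> ((nat \<Rightarrow> complex^2^2) \<times> (nat \<Rightarrow> complex^2^2)) set" where
  "pi_rel n = {(f, g). f \<in> su2_tuples n \<and> g \<in> su2_tuples n \<and>
     (\<exists>h\<in>SU2. \<exists>q\<in>SU2. \<forall>j<n. g j = h ** f j ** q)}"

definition Pi_space :: "nat \<Rightarrow> (nat \<Rightarrow> complex^2^2) set set" where
  "Pi_space n = su2_tuples n // pi_rel n"

definition pi_class :: "nat \<Rightarrow> (nat \<Rightarrow> complex^2^2) \<Rightarrow> (nat \<Rightarrow> complex^2^2) set" where
  "pi_class n f = pi_rel n `` {f}"

section \<open>The spectral form\<close>

definition spectral_form :: "nat \<Rightarrow> (nat \<Rightarrow> complex^2^2) \<Rightarrow> (nat \<Rightarrow> real) \<Rightarrow> complex" where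
  "spectral_form n g l = det (\<Sum>j<n. l j *\<^sub>R g j)"

text \<open>\<open>A\<close> is the symmetric real \<open>n \<times> n\<close> matrix of the (a priori complex valued) form \<open>Q\<close>.\<close>

definition is_form_matrix ::
  "nat \<Rightarrow> ((nat \<Rightarrow> real) \<Rightarrow> complex) \<Rightarrow> (nat \<Rightarrow> nat \<Rightarrow> real) \<Rightarrow> bool" where
  "is_form_matrix n Q A \<longleftrightarrow>
     (\<forall>i<n. \<forall>j<n. A i j = A j i) \<and>
     (\<forall>l. Q l = complex_of_real (\<Sum>i<n. \<Sum>j<n. A i j * l i * l j))"

definition bordered_matrix :: "(nat \<Rightarrow> real) \<Rightarrow> (nat \<Rightarrow> nat \<Rightarrow> real) \<Rightarrow> nat \<Rightarrow> nat \<Rightarrow> real" where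
  "bordered_matrix p h i j =
     (if i = j then 1 else if i = 0 then p j else if j = 0 then p i else h i j)"

section \<open>The braid group and its action\<close>

text \<open>The Artin presentation of the braid group on \<open>m\<close> strands. A letter \<open>(k, True)\<close> stands
  for \<open>\<sigma>\<^sub>k\<close> and \<open>(k, False)\<close> for its inverse.\<close>

type_synonym braid_word = "(nat \<times> bool) list"

definition braid_words :: "nat \<Rightarrow> braid_word set" where
  "braid_words m = lists ({1..<m} \<times> UNIV)"

inductive braid_eq :: "nat \<Rightarrow> braid_word \<Rightarrow> braid_word \<Rightarrow> bool" for m where
  refl: "w \<in> braid_words m \<Longrightarrow> braid_eq m w w"
| sym: "braid_eq m u v \<Longrightarrow> braid_eq m v u"
| trans: "braid_eq m u v \<Longrightarrow> braid_eq m v w \<Longrightarrow> braid_eq m u w"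
| congr: "braid_eq m u v \<Longrightarrow> a \<in> braid_words m \<Longrightarrow> b \<in> braid_words m \<Longrightarrow>
    braid_eq m (a @ u @ b) (a @ v @ b)"
| cancel: "k \<in> {1..<m} \<Longrightarrow> braid_eq m [(k, e), (k, \<not> e)] []"
| far: "i \<in> {1..<m} \<Longrightarrow> j \<in> {1..<m} \<Longrightarrow> Suc i < j \<Longrightarrow>
    braid_eq m [(i, True), (j, True)] [(j, True), (i, True)]"
| braid: "i \<in> {1..<m} \<Longrightarrow> Suc i \<in> {1..<m} \<Longrightarrow>
    braid_eq m [(i, True), (Suc i, True), (i, True)] [(Suc i, True), (i, True), (Suc i, True)]"

definition braid_class :: "nat \<Rightarrow> braid_word \<Rightarrow> braid_word set" where
  "braid_class m w = {v. braid_eq m w v}"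

definition braid_group :: "nat \<Rightarrow> braid_word set monoid" where
  "braid_group m =
     \<lparr>carrier = braid_class m ` braid_words m,
      mult = (\<lambda>U V. \<Union>u\<in>U. \<Union>v\<in>V. braid_class m (u @ v)),
      one = braid_class m []\<rparr>"

definition braid_sigma :: "nat \<Rightarrow> nat \<Rightarrow> braid_word set" where
  "braid_sigma m k = braid_class m [(k, True)]"

definition braid_move :: "nat \<Rightarrow> (nat \<Rightarrow> complex^2^2) \<Rightarrow> nat \<Rightarrow> complex^2^2" where
  "braid_move k c = c(k := c k ** c (Suc k) ** matrix_inv (c k), Suc k := c k)"

definition sigma_act ::
  "nat \<Rightarrow> nat \<Rightarrow> (nat \<Rightarrow> complex^2^2) set \<Rightarrow> (nat \<Rightarrow> complex^2^2) set" where
  "sigma_act n k X = (\<Union>c\<in>{c\<in>X. c 0 = mat 1}. pi_class n (braid_move k c))"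

definition letter_act ::
  "nat \<Rightarrow> nat \<times> bool \<Rightarrow> (nat \<Rightarrow> complex^2^2) set \<Rightarrow> (nat \<Rightarrow> complex^2^2) set" where
  "letter_act n x =
     (if snd x then sigma_act n (fst x) else inv_into (Pi_space n) (sigma_act n (fst x)))"

text \<open>The action of \<open>Br\<^sub>n\<^sub>-\<^sub>1\<close> on \<open>\<Pi>(n)\<close>; the value does not depend on the word chosen to
  represent the braid (lemma \<open>braid_act_class\<close> below).\<close>

definition braid_act ::
  "nat \<Rightarrow> braid_word set \<Rightarrow> (nat \<Rightarrow> complex^2^2) set \<Rightarrow> (nat \<Rightarrow> complex^2^2) set" where
  "braid_act n W = (\<lambda>X\<in>Pi_space n. foldr (letter_act n) (SOME w. w \<in> W) X)"

section \<open>Diagonalising a component\<close>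

text \<open>Conjugation by \<open>u\<close> brings \<open>c\<close> to \<open>diag(e\<^sup>i\<^sup>\<phi>, e\<^sup>-\<^sup>i\<^sup>\<phi>)\<close>.\<close>

definition diagonalises :: "complex^2^2 \<Rightarrow> real \<Rightarrow> complex^2^2 \<Rightarrow> bool" where
  "diagonalises u \<phi> c \<longleftrightarrow> u \<in> SU2 \<and> 0 \<le> \<phi> \<and> \<phi> \<le> pi \<and>
     u ** c ** matrix_inv u = vector [vector [cis \<phi>, 0], vector [0, cis (- \<phi>)]]"

section \<open>Well-definedness\<close>

lemma vector_4 [simp]:
  "(vector [x, y, z, w] :: ('a::zero)^4) $ 1 = x"
  "(vector [x, y, z, w] :: ('a::zero)^4) $ 2 = y"
  "(vector [x, y, z, w] :: ('a::zero)^4) $ 3 = z"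
  "(vector [x, y, z, w] :: ('a::zero)^4) $ 4 = w"
  unfolding vector_def by simp_all

lemma mat2_eq_iff:
  "(A :: 'a^2^2) = B \<longleftrightarrow> A$1$1 = B$1$1 \<and> A$1$2 = B$1$2 \<and> A$2$1 = B$2$1 \<and> A$2$2 = B$2$2"
  by (auto simp: vec_eq_iff forall_2)

lemma mat2_add_rdistrib: "(A + B) ** C = A ** C + B ** (C :: complex^2^2)"
  by (simp add: vec_eq_iff matrix_matrix_mult_def sum_2 distrib_right)

lemma adj_mult: "adj (A ** B) = adj B ** adj A"
  by (simp add: adj_def matrix_matrix_mult_def vec_eq_iff mult.commute)

lemma SU2_one: "mat 1 \<in> SU2"
  by (simp add: SU2_def adj_def mat2_eq_iff matrix_matrix_mult_def sum_2 mat_def det_2)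

lemma SU2_mult:
  assumes "A \<in> SU2" "B \<in> SU2" shows "A ** B \<in> SU2"
proof -
  have "adj (A ** B) ** (A ** B) = adj B ** ((adj A ** A) ** B)"
    by (simp add: adj_mult matrix_mul_assoc)
  also have "\<dots> = mat 1" using assms by (simp add: SU2_def)
  finally show ?thesis using assms by (simp add: SU2_def det_mul)
qed

lemma SU2_inv_eq:
  assumes "A \<in> SU2"
  shows "adj A ** A = mat 1" "A ** adj A = mat 1" "matrix_inv A = adj A"
proof -
  show 1: "adj A ** A = mat 1" using assms by (simp add: SU2_def)
  show 2: "A ** adj A = mat 1" using 1 matrix_left_right_inverse by blast
  have "A ** matrix_inv A = mat 1 \<and> matrix_inv A ** A = mat 1"
    unfolding matrix_inv_def by (rule someI_ex) (use 1 2 in blast)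
  then show "matrix_inv A = adj A"
    by (metis 1 matrix_mul_assoc matrix_mul_lid matrix_mul_rid)
qed

lemma SU2_linv [simp]: "A \<in> SU2 \<Longrightarrow> matrix_inv A ** A = mat 1"
  and SU2_rinv [simp]: "A \<in> SU2 \<Longrightarrow> A ** matrix_inv A = mat 1"
  by (simp_all add: SU2_inv_eq)

lemma SU2_linv_assoc [simp]: "A \<in> SU2 \<Longrightarrow> B ** matrix_inv A ** A = B"
  and SU2_rinv_assoc [simp]: "A \<in> SU2 \<Longrightarrow> B ** A ** matrix_inv A = B"
  by (simp_all add: matrix_mul_assoc[symmetric])

lemma SU2_inv:
  assumes "A \<in> SU2" shows "matrix_inv A \<in> SU2"
proof -
  have d: "det A = 1" using assms by (simp add: SU2_def)
  have "det (adj A) * det A = 1"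
    by (metis SU2_inv_eq(1) assms det_I det_mul)
  then have "det (adj A) = 1" using d by simp
  moreover have "adj (adj A) = A" by (simp add: adj_def vec_eq_iff)
  ultimately show ?thesis using SU2_inv_eq[OF assms] by (simp add: SU2_def)
qed

lemma SU2_inv_unique:
  assumes "A \<in> SU2" "A ** B = mat 1" shows "matrix_inv A = B"
  by (metis assms SU2_linv matrix_mul_assoc matrix_mul_lid matrix_mul_rid)

lemma SU2_inv_mult:
  assumes "A \<in> SU2" "B \<in> SU2" shows "matrix_inv (A ** B) = matrix_inv B ** matrix_inv A"
  by (rule SU2_inv_unique) (use assms in \<open>simp_all add: SU2_mult matrix_mul_assoc\<close>)

lemma SU2_inv_inv [simp]: "A \<in> SU2 \<Longrightarrow> matrix_inv (matrix_inv A) = A"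
  by (simp add: SU2_inv SU2_inv_unique)

lemma SU2_entries:
  assumes "A \<in> SU2"
  shows "A$2$2 = cnj (A$1$1)" "A$2$1 = - cnj (A$1$2)"
    "(cmod (A$1$1))\<^sup>2 + (cmod (A$1$2))\<^sup>2 = 1"
proof -
  let ?a = "A$1$1" and ?b = "A$1$2" and ?c = "A$2$1" and ?d = "A$2$2"
  have e: "adj A ** A = mat 1" "A ** adj A = mat 1" "det A = 1"
    using SU2_inv_eq[OF assms] assms by (simp_all add: SU2_def)
  have d: "?a * ?d - ?b * ?c = 1" using e(3) by (simp add: det_2)
  have 1: "?a * cnj ?a + ?b * cnj ?b = 1" "?c * cnj ?a + ?d * cnj ?b = 0"
    using e(2) by (simp_all add: mat2_eq_iff adj_def matrix_matrix_mult_def sum_2 mat_def)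
  have "cnj ?a = cnj ?a * (?a * ?d - ?b * ?c)" by (simp only: d mult_1_right)
  also have "\<dots> = ?d * (?a * cnj ?a + ?b * cnj ?b) - ?b * (?c * cnj ?a + ?d * cnj ?b)"
    by (simp add: algebra_simps)
  finally show "?d = cnj ?a" using 1 by simp
  have "- cnj ?b = - cnj ?b * (?a * ?d - ?b * ?c)" by (simp only: d mult_1_right)
  also have "\<dots> = ?c * (?a * cnj ?a + ?b * cnj ?b) - ?a * (?c * cnj ?a + ?d * cnj ?b)"
    by (simp add: algebra_simps)
  finally show "?c = - cnj ?b" using 1 by simp
  have "complex_of_real ((cmod ?a)\<^sup>2 + (cmod ?b)\<^sup>2) = complex_of_real 1"
    using 1(1) by (simp add: complex_norm_square del: of_real_power)
  then show "(cmod ?a)\<^sup>2 + (cmod ?b)\<^sup>2 = 1" using of_real_eq_iff by blast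
qed

lemma matrix_mult_sum_scaleR:
  fixes h q :: "complex^2^2" and g :: "nat \<Rightarrow> complex^2^2"
  shows "(\<Sum>j<n. (l j :: real) *\<^sub>R (h ** g j ** q)) = h ** (\<Sum>j<n. l j *\<^sub>R g j) ** q"
proof (induction n)
  case 0 show ?case by (simp add: mat2_eq_iff matrix_matrix_mult_def)
next
  case (Suc n)
  have "h ** (l n *\<^sub>R g n) ** q = l n *\<^sub>R (h ** g n ** q)"
    by (simp add: mat2_eq_iff matrix_matrix_mult_def sum_2 scaleR_add_right distrib_right)
  then show ?case using Suc by (simp add: matrix_add_ldistrib mat2_add_rdistrib)
qed

lemma spectral_form_pi_rel:
  assumes "(f, g) \<in> pi_rel n" shows "spectral_form n g = spectral_form n f"
proof
  fix l
  obtain h q where hq: "h \<in> SU2" "q \<in> SU2" "\<forall>j<n. g j = h ** f j ** q"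
    using assms by (auto simp: pi_rel_def)
  have "(\<Sum>j<n. l j *\<^sub>R g j) = (\<Sum>j<n. l j *\<^sub>R (h ** f j ** q))"
    using hq by (intro sum.cong) auto
  then show "spectral_form n g l = spectral_form n f l"
    using hq by (simp add: spectral_form_def matrix_mult_sum_scaleR det_mul SU2_def)
qed

lemma is_form_matrix_exists:
  assumes c: "c \<in> su2_tuples n"
  shows "\<exists>p h. (\<forall>i j. h i j = h j i) \<and> is_form_matrix n (spectral_form n c) (bordered_matrix p h)"
proof -
  define a where "a i = c i $ 1 $ 1" for i
  define b where "b i = c i $ 1 $ 2" for i
  define A where "A i j = Re (a i * cnj (a j) + b i * cnj (b j))" for i j
  have mem: "c i \<in> SU2" if "i < n" for i using c that by (auto simp: su2_tuples_def)
  have A1: "A i i = 1" if "i < n" for i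
    using SU2_entries(3)[OF mem[OF that]]
    unfolding A_def a_def b_def cmod_power2 by (simp add: power2_eq_square)
  have sym: "A i j = A j i" for i j by (simp add: A_def algebra_simps)
  have form: "spectral_form n c l = complex_of_real (\<Sum>i<n. \<Sum>j<n. A i j * l i * l j)" for l
  proof -
    define S where "S = (\<Sum>j<n. l j *\<^sub>R c j)"
    define u where "u = (\<Sum>j<n. of_real (l j) * a j)"
    define v where "v = (\<Sum>j<n. of_real (l j) * b j)"
    have S: "S $ 1 $ 1 = u" "S $ 1 $ 2 = v" "S $ 2 $ 1 = - cnj v" "S $ 2 $ 2 = cnj u"
      by (simp_all add: S_def u_def v_def a_def b_def scaleR_conv_of_real[where 'a = complex] SU2_entries(1,2)[OF mem]
          sum_negf[symmetric])
    have "det S = u * cnj u + v * cnj v" by (simp add: det_2 S)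
    also have "\<dots> = complex_of_real (Re (u * cnj u + v * cnj v))"
      by (simp add: complex_eq_iff)
    also have "u * cnj u + v * cnj v =
        (\<Sum>i<n. \<Sum>j<n. of_real (l i * l j) * (a i * cnj (a j) + b i * cnj (b j)))"
      by (simp add: u_def v_def sum_product sum.distrib[symmetric] algebra_simps)
    also have "Re \<dots> = (\<Sum>i<n. \<Sum>j<n. A i j * l i * l j)"
      by (simp add: A_def Re_sum algebra_simps)
    finally show ?thesis by (simp add: spectral_form_def S_def)
  qed
  have bord: "bordered_matrix (A 0) A i j = A i j" if "i < n" "j < n" for i j
    using that A1 sym by (auto simp: bordered_matrix_def)
  have "is_form_matrix n (spectral_form n c) (bordered_matrix (A 0) A)"
    unfolding is_form_matrix_def using form sym bord by simp
  then show ?thesis using sym by blast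
qed

lemma quadratic_form_eval:
  fixes A :: "nat \<Rightarrow> nat \<Rightarrow> real"
  assumes "r < n" "s < n"
  shows "(\<Sum>i<n. \<Sum>j<n. A i j * of_bool (i = r) * of_bool (j = s)) = A r s"
proof -
  have "(\<Sum>j<n. A i j * of_bool (i = r) * of_bool (j = s)) = (if i = r then A r s else 0)" for i
    using assms by (simp add: of_bool_def mult_delta_right)
  then show ?thesis using assms by simp
qed

lemma is_form_matrix_unique:
  assumes "is_form_matrix n Q A" "is_form_matrix n Q B" "r < n" "s < n"
  shows "A r s = B r s"
proof -
  have eq: "(\<Sum>i<n. \<Sum>j<n. A i j * l i * l j) = (\<Sum>i<n. \<Sum>j<n. B i j * l i * l j)" for l
  proof -
    have "complex_of_real (\<Sum>i<n. \<Sum>j<n. A i j * l i * l j) =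
        complex_of_real (\<Sum>i<n. \<Sum>j<n. B i j * l i * l j)"
      using assms(1,2) unfolding is_form_matrix_def by metis
    then show ?thesis by (simp only: of_real_eq_iff)
  qed
  have d: "A i i = B i i" if "i < n" for i
    using eq[of "\<lambda>j. of_bool (j = i)"] that by (simp only: quadratic_form_eval)
  show ?thesis
  proof (cases "r = s")
    case False
    have expand: "(\<Sum>i<n. \<Sum>j<n. M i j * (of_bool (i = r) + of_bool (i = s)) *
        (of_bool (j = r) + of_bool (j = s))) = M r r + M r s + M s r + M s s" for M :: "nat \<Rightarrow> nat \<Rightarrow> real"
      using assms(3,4) by (simp only: distrib_left distrib_right sum.distrib quadratic_form_eval)
    have "A r r + A r s + A s r + A s s = B r r + B r s + B s r + B s s"
      using eq[of "\<lambda>j. of_bool (j = r) + of_bool (j = s)"] by (simp only: expand)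
    moreover have "A s r = A r s" "B s r = B r s"
      using assms by (auto simp: is_form_matrix_def)
    ultimately show ?thesis using d assms(3,4) by simp
  qed (use d assms in simp)
qed

lemma su2_tuples_iff:
  "f \<in> su2_tuples n \<longleftrightarrow> (\<forall>i<n. f i \<in> SU2) \<and> (\<forall>i\<ge>n. f i = undefined)"
  unfolding su2_tuples_def PiE_iff extensional_def by auto

lemma equiv_pi_rel: "equiv (su2_tuples n) (pi_rel n)"
proof (rule equivI)
  show "pi_rel n \<subseteq> su2_tuples n \<times> su2_tuples n" by (auto simp: pi_rel_def)
  show "refl_on (su2_tuples n) (pi_rel n)"
    by (rule refl_onI) (auto simp: pi_rel_def intro!: bexI[of _ "mat 1"] SU2_one)
  show "sym (pi_rel n)"
  proof (rule symI)
    fix f g assume "(f, g) \<in> pi_rel n"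
    then obtain h q where *: "h \<in> SU2" "q \<in> SU2" "\<forall>j<n. g j = h ** f j ** q"
      "f \<in> su2_tuples n" "g \<in> su2_tuples n" by (auto simp: pi_rel_def)
    have "f j = matrix_inv h ** g j ** matrix_inv q" if "j < n" for j
      using * that by (simp add: matrix_mul_assoc)
    with * show "(g, f) \<in> pi_rel n" unfolding pi_rel_def
      using SU2_inv by blast
  qed
  show "trans (pi_rel n)"
  proof (rule transI)
    fix e f g assume "(e, f) \<in> pi_rel n" "(f, g) \<in> pi_rel n"
    then obtain h q h' q' where *: "h \<in> SU2" "q \<in> SU2" "\<forall>j<n. f j = h ** e j ** q"
      "h' \<in> SU2" "q' \<in> SU2" "\<forall>j<n. g j = h' ** f j ** q'"
      "e \<in> su2_tuples n" "g \<in> su2_tuples n" by (auto simp: pi_rel_def)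
    have "g j = (h' ** h) ** e j ** (q ** q')" if "j < n" for j
      using * that by (simp add: matrix_mul_assoc)
    with * show "(e, g) \<in> pi_rel n" unfolding pi_rel_def
      using SU2_mult by blast
  qed
qed

lemma pi_class_eq_iff:
  "f \<in> su2_tuples n \<Longrightarrow> g \<in> su2_tuples n \<Longrightarrow> pi_class n f = pi_class n g \<longleftrightarrow> (f, g) \<in> pi_rel n"
  unfolding pi_class_def using eq_equiv_class_iff[OF equiv_pi_rel] by blast

lemma pi_class_self: "f \<in> su2_tuples n \<Longrightarrow> f \<in> pi_class n f"
  unfolding pi_class_def using equiv_class_self[OF equiv_pi_rel] by blast

lemma pi_class_in: "f \<in> su2_tuples n \<Longrightarrow> pi_class n f \<in> Pi_space n"
  unfolding pi_class_def Pi_space_def by (rule quotientI)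

lemma pi_space_class:
  assumes "X \<in> Pi_space n" "f \<in> X" shows "f \<in> su2_tuples n" "X = pi_class n f"
proof -
  show "f \<in> su2_tuples n"
    using assms in_quotient_imp_subset[OF equiv_pi_rel] unfolding Pi_space_def by blast
  show "X = pi_class n f"
    using assms unfolding Pi_space_def pi_class_def
    by (metis Image_singleton_iff equiv_class_eq[OF equiv_pi_rel] quotientE)
qed

lemma pi_space_normalised:
  assumes "X \<in> Pi_space n" "0 < n"
  obtains c where "c \<in> su2_tuples n" "c 0 = mat 1" "c \<in> X" "X = pi_class n c"
proof -
  obtain f where f: "f \<in> su2_tuples n" "X = pi_class n f"
    using assms unfolding Pi_space_def pi_class_def by (auto elim: quotientE)
  have mem: "f i \<in> SU2" if "i < n" for i using f that by (auto simp: su2_tuples_def)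
  define c where "c = (\<lambda>j\<in>{..<n}. f j ** matrix_inv (f 0))"
  have c: "c \<in> su2_tuples n" using mem assms by (auto simp: c_def su2_tuples_def SU2_mult SU2_inv)
  have "(f, c) \<in> pi_rel n"
  proof -
    have "\<forall>j<n. c j = mat 1 ** f j ** matrix_inv (f 0)" by (simp add: c_def)
    moreover have "matrix_inv (f 0) \<in> SU2" using mem assms by (simp add: SU2_inv)
    ultimately show ?thesis unfolding pi_rel_def using f(1) c SU2_one by blast
  qed
  then have X: "X = pi_class n c" using f c pi_class_eq_iff by blast
  have "c 0 = mat 1" using mem assms by (simp add: c_def)
  with c X show thesis using that pi_class_self by blast
qed

lemma braid_move_tuple:
  assumes "c \<in> su2_tuples n" "Suc k < n" shows "braid_move k c \<in> su2_tuples n"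
  using assms by (simp add: su2_tuples_iff braid_move_def SU2_mult SU2_inv)

lemma braid_move_0: "1 \<le> k \<Longrightarrow> braid_move k c 0 = c 0"
  by (simp add: braid_move_def)

lemma pi_rel_normalised:
  assumes "(c, d) \<in> pi_rel n" "c 0 = mat 1" "d 0 = mat 1" "0 < n"
  obtains h where "h \<in> SU2" "\<forall>j<n. d j = h ** c j ** matrix_inv h"
proof -
  obtain h q where *: "h \<in> SU2" "q \<in> SU2" "\<forall>j<n. d j = h ** c j ** q"
    using assms by (auto simp: pi_rel_def)
  then have "h ** q = mat 1" using assms by auto
  then have "q = matrix_inv h" using * SU2_inv_unique by metis
  with * that show thesis by blast
qed

lemma braid_move_pi_rel:
  assumes "(c, d) \<in> pi_rel n" "c 0 = mat 1" "d 0 = mat 1" "Suc k < n"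
  shows "(braid_move k c, braid_move k d) \<in> pi_rel n"
proof -
  obtain h where h: "h \<in> SU2" "\<forall>j<n. d j = h ** c j ** matrix_inv h"
    using pi_rel_normalised assms by (metis gr0I not_less_zero)
  have t: "c \<in> su2_tuples n" "d \<in> su2_tuples n" using assms by (auto simp: pi_rel_def)
  have mem: "c i \<in> SU2" if "i < n" for i using t that by (auto simp: su2_tuples_def)
  have "braid_move k d j = h ** braid_move k c j ** matrix_inv h" if "j < n" for j
    using that h assms(4) mem
    by (simp add: braid_move_def SU2_inv_mult SU2_mult SU2_inv matrix_mul_assoc)
  then show ?thesis unfolding pi_rel_def
    using h SU2_inv braid_move_tuple t assms by blast
qed

lemma sigma_act_class:
  assumes "c \<in> su2_tuples n" "c 0 = mat 1" "Suc k < n"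
  shows "sigma_act n k (pi_class n c) = pi_class n (braid_move k c)"
proof -
  have "pi_class n (braid_move k d) = pi_class n (braid_move k c)"
    if "d \<in> pi_class n c" "d 0 = mat 1" for d
  proof -
    have "(c, d) \<in> pi_rel n" using that by (simp add: pi_class_def)
    moreover have "d \<in> su2_tuples n" using calculation by (simp add: pi_rel_def)
    ultimately show ?thesis
      using braid_move_pi_rel assms that braid_move_tuple pi_class_eq_iff by metis
  qed
  moreover have "c \<in> {d \<in> pi_class n c. d 0 = mat 1}" using assms pi_class_self by simp
  ultimately show ?thesis unfolding sigma_act_def by blast
qed

definition braid_move_inv :: "nat \<Rightarrow> (nat \<Rightarrow> complex^2^2) \<Rightarrow> nat \<Rightarrow> complex^2^2" where
  "braid_move_inv k c = c(k := c (Suc k), Suc k := matrix_inv (c (Suc k)) ** c k ** c (Suc k))"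

lemma braid_move_inv:
  assumes "c \<in> su2_tuples n" "Suc k < n"
  shows "braid_move_inv k c \<in> su2_tuples n" "braid_move k (braid_move_inv k c) = c"
    "braid_move_inv k (braid_move k c) = c"
proof -
  have mem: "c i \<in> SU2" if "i < n" for i using assms that by (auto simp: su2_tuples_def)
  show "braid_move_inv k c \<in> su2_tuples n"
    using assms by (simp add: su2_tuples_iff braid_move_inv_def SU2_mult SU2_inv)
  show "braid_move k (braid_move_inv k c) = c" "braid_move_inv k (braid_move k c) = c"
    using mem[of k] mem[of "Suc k"] assms(2)
    by (auto simp: fun_eq_iff braid_move_def braid_move_inv_def matrix_mul_assoc)
qed

lemma braid_move_inv_pi_rel:
  assumes "(c, d) \<in> pi_rel n" "c 0 = mat 1" "d 0 = mat 1" "Suc k < n"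
  shows "(braid_move_inv k c, braid_move_inv k d) \<in> pi_rel n"
proof -
  obtain h where h: "h \<in> SU2" "\<forall>j<n. d j = h ** c j ** matrix_inv h"
    using pi_rel_normalised assms by (metis gr0I not_less_zero)
  have t: "c \<in> su2_tuples n" "d \<in> su2_tuples n" using assms by (auto simp: pi_rel_def)
  have mem: "c i \<in> SU2" if "i < n" for i using t that by (auto simp: su2_tuples_def)
  have "braid_move_inv k d j = h ** braid_move_inv k c j ** matrix_inv h" if "j < n" for j
    using that h assms(4) mem
    by (simp add: braid_move_inv_def SU2_inv_mult SU2_mult SU2_inv matrix_mul_assoc)
  then show ?thesis unfolding pi_rel_def
    using h SU2_inv braid_move_inv(1) t assms by blast
qed

lemma sigma_act_bij:
  assumes k: "1 \<le> k" "Suc k < n"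
  shows "bij_betw (sigma_act n k) (Pi_space n) (Pi_space n)"
  unfolding bij_betw_def
proof (intro conjI inj_onI)
  have n: "0 < n" using k by simp
  show "sigma_act n k ` Pi_space n = Pi_space n"
  proof (intro equalityI subsetI)
    fix Y assume "Y \<in> sigma_act n k ` Pi_space n"
    then obtain X where "X \<in> Pi_space n" "Y = sigma_act n k X" by blast
    then show "Y \<in> Pi_space n"
      using pi_space_normalised[OF _ n] sigma_act_class k pi_class_in braid_move_tuple by metis
  next
    fix Y assume "Y \<in> Pi_space n"
    then obtain c where c: "c \<in> su2_tuples n" "c 0 = mat 1" "Y = pi_class n c"
      using pi_space_normalised[OF _ n] by metis
    have "braid_move_inv k c 0 = mat 1" using c k by (simp add: braid_move_inv_def)
    then have "sigma_act n k (pi_class n (braid_move_inv k c)) = Y"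
      using sigma_act_class braid_move_inv c k by simp
    then show "Y \<in> sigma_act n k ` Pi_space n"
      using pi_class_in braid_move_inv(1) c k by blast
  qed
  fix X Y assume "X \<in> Pi_space n" "Y \<in> Pi_space n" and eq: "sigma_act n k X = sigma_act n k Y"
  then obtain c d where c: "c \<in> su2_tuples n" "c 0 = mat 1" "X = pi_class n c"
    and d: "d \<in> su2_tuples n" "d 0 = mat 1" "Y = pi_class n d"
    using pi_space_normalised[OF _ n] by metis
  have "(braid_move k c, braid_move k d) \<in> pi_rel n"
    using eq c d k by (simp add: sigma_act_class pi_class_eq_iff braid_move_tuple)
  from braid_move_inv_pi_rel[OF this _ _ k(2)]
  have "(c, d) \<in> pi_rel n" using c d k by (simp add: braid_move_0 braid_move_inv)
  then show "X = Y" using c d by (simp add: pi_class_eq_iff)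
qed

lemma sigma_act_in:
  "1 \<le> k \<Longrightarrow> Suc k < n \<Longrightarrow> X \<in> Pi_space n \<Longrightarrow> sigma_act n k X \<in> Pi_space n"
  using sigma_act_bij bij_betwE by blast

lemma sigma_act_far:
  assumes "1 \<le> i" "Suc i < j" "Suc j < n" "X \<in> Pi_space n"
  shows "sigma_act n i (sigma_act n j X) = sigma_act n j (sigma_act n i X)"
proof -
  obtain c where c: "c \<in> su2_tuples n" "c 0 = mat 1" "X = pi_class n c"
    using pi_space_normalised assms by (metis gr0I not_less_zero)
  have "braid_move i (braid_move j c) = braid_move j (braid_move i c)"
    using assms by (auto simp: braid_move_def fun_eq_iff)
  then show ?thesis
    using c assms by (simp add: sigma_act_class braid_move_tuple braid_move_0)
qed

lemma sigma_act_braid: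
  assumes "1 \<le> i" "Suc (Suc i) < n" "X \<in> Pi_space n"
  shows "sigma_act n i (sigma_act n (Suc i) (sigma_act n i X)) =
    sigma_act n (Suc i) (sigma_act n i (sigma_act n (Suc i) X))"
proof -
  obtain c where c: "c \<in> su2_tuples n" "c 0 = mat 1" "X = pi_class n c"
    using pi_space_normalised assms by (metis gr0I not_less_zero)
  have mem: "c i \<in> SU2" if "i < n" for i using c that by (auto simp: su2_tuples_def)
  have "braid_move i (braid_move (Suc i) (braid_move i c)) =
      braid_move (Suc i) (braid_move i (braid_move (Suc i) c))"
    using assms mem[of i] mem[of "Suc i"] mem[of "Suc (Suc i)"]
    by (auto simp: braid_move_def fun_eq_iff SU2_inv_mult SU2_mult SU2_inv matrix_mul_assoc)
  then show ?thesis
    using c assms by (simp add: sigma_act_class braid_move_tuple braid_move_0)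
qed

lemma letter_act_bij:
  assumes "x \<in> {1..<n - 1} \<times> UNIV"
  shows "bij_betw (letter_act n x) (Pi_space n) (Pi_space n)"
proof -
  have "bij_betw (sigma_act n (fst x)) (Pi_space n) (Pi_space n)"
    using assms by (intro sigma_act_bij) auto
  then show ?thesis by (simp add: letter_act_def bij_betw_inv_into)
qed

lemma word_act_bij:
  assumes "w \<in> braid_words (n - 1)"
  shows "bij_betw (foldr (letter_act n) w) (Pi_space n) (Pi_space n)"
  using assms unfolding braid_words_def
proof (induction w)
  case Nil show ?case by (simp add: bij_betw_def)
next
  case (Cons x w)
  then have x: "bij_betw (letter_act n x) (Pi_space n) (Pi_space n)"
    and w: "bij_betw (foldr (letter_act n) w) (Pi_space n) (Pi_space n)"
    using letter_act_bij by auto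
  show ?case using bij_betw_trans[OF w x] by (simp add: o_def)
qed

lemma word_act_in:
  "w \<in> braid_words (n - 1) \<Longrightarrow> X \<in> Pi_space n \<Longrightarrow> foldr (letter_act n) w X \<in> Pi_space n"
  using word_act_bij bij_betwE by blast

lemma braid_words_append [simp]:
  "u @ v \<in> braid_words m \<longleftrightarrow> u \<in> braid_words m \<and> v \<in> braid_words m"
  by (auto simp: braid_words_def)

lemma braid_words_Nil [simp]: "[] \<in> braid_words m"
  by (simp add: braid_words_def)

lemma braid_words_Cons [simp]:
  "x # w \<in> braid_words m \<longleftrightarrow> x \<in> {1..<m} \<times> UNIV \<and> w \<in> braid_words m"
  by (auto simp: braid_words_def)

lemma braid_eq_words: "braid_eq m u v \<Longrightarrow> u \<in> braid_words m \<and> v \<in> braid_words m"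
  by (induction rule: braid_eq.induct) auto

lemma braid_eq_act:
  "braid_eq (n - 1) u v \<Longrightarrow> X \<in> Pi_space n \<Longrightarrow>
    foldr (letter_act n) u X = foldr (letter_act n) v X"
proof (induction arbitrary: X rule: braid_eq.induct)
  case (congr u v a b)
  then show ?case by (simp add: word_act_in)
next
  case (cancel k e)
  then have "bij_betw (sigma_act n k) (Pi_space n) (Pi_space n)"
    by (intro sigma_act_bij) auto
  then show ?case using cancel
    by (cases e) (auto simp: letter_act_def bij_betw_inv_into_left bij_betw_inv_into_right)
next
  case (far i j)
  then have "Suc j < n" by auto
  then show ?case using far sigma_act_far[of i j n X] by (simp add: letter_act_def)
next
  case (braid i)
  then have "Suc (Suc i) < n" by auto
  then show ?case using braid sigma_act_braid[of i n X] by (simp add: letter_act_def)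
qed auto

lemma braid_class_eq: "braid_eq m u v \<Longrightarrow> braid_class m u = braid_class m v"
  unfolding braid_class_def by (blast intro: braid_eq.sym braid_eq.trans)

lemma braid_class_self: "w \<in> braid_words m \<Longrightarrow> w \<in> braid_class m w"
  by (simp add: braid_class_def braid_eq.refl)

lemma braid_eq_append:
  assumes "braid_eq m u u'" "braid_eq m v v'" shows "braid_eq m (u @ v) (u' @ v')"
proof -
  have w: "u \<in> braid_words m" "u' \<in> braid_words m" "v \<in> braid_words m" "v' \<in> braid_words m"
    using assms braid_eq_words by auto
  have "braid_eq m ([] @ u @ v) ([] @ u' @ v)"
    by (rule braid_eq.congr) (use assms w in auto)
  moreover have "braid_eq m (u' @ v @ []) (u' @ v' @ [])"
    by (rule braid_eq.congr) (use assms w in auto)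
  ultimately show ?thesis using braid_eq.trans by auto
qed

lemma braid_mult_class:
  assumes "u \<in> braid_words m" "v \<in> braid_words m"
  shows "braid_class m u \<otimes>\<^bsub>braid_group m\<^esub> braid_class m v = braid_class m (u @ v)"
proof -
  have *: "braid_class m (u' @ v') = braid_class m (u @ v)"
    if "u' \<in> braid_class m u" "v' \<in> braid_class m v" for u' v'
  proof -
    have "braid_eq m (u @ v) (u' @ v')"
      using that by (intro braid_eq_append) (simp_all add: braid_class_def)
    then show ?thesis using braid_class_eq by simp
  qed
  have "u \<in> braid_class m u" "v \<in> braid_class m v" using assms braid_class_self by auto
  then have "(\<Union>u'\<in>braid_class m u. \<Union>v'\<in>braid_class m v. braid_class m (u' @ v')) =
      braid_class m (u @ v)"
    using * by blast
  then show ?thesis by (simp add: braid_group_def)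
qed

lemma group_braid_group: "group (braid_group m)"
proof (rule groupI)
  have car: "carrier (braid_group m) = braid_class m ` braid_words m"
    and one: "\<one>\<^bsub>braid_group m\<^esub> = braid_class m []" by (simp_all add: braid_group_def)
  show "\<one>\<^bsub>braid_group m\<^esub> \<in> carrier (braid_group m)" by (simp add: car one)
  fix U assume "U \<in> carrier (braid_group m)"
  then obtain u where u: "u \<in> braid_words m" "U = braid_class m u" by (auto simp: car)
  show "\<one>\<^bsub>braid_group m\<^esub> \<otimes>\<^bsub>braid_group m\<^esub> U = U"
    using u by (simp add: one braid_mult_class)
  define v where "v = rev (map (\<lambda>(k, e). (k, \<not> e)) u)"
  have "v \<in> braid_words m \<and> braid_eq m (v @ u) []"
    unfolding v_def using u(1)
  proof (induction u)
    case Nil show ?case by (simp add: braid_eq.refl)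
  next
    case (Cons x u)
    obtain k e where x: "x = (k, e)" by (cases x)
    let ?i = "rev (map (\<lambda>(k, e). (k, \<not> e)) u)"
    have i: "?i \<in> braid_words m" "braid_eq m (?i @ u) []" and k: "k \<in> {1..<m}"
      using Cons x by auto
    have "braid_eq m [(k, \<not> e), (k, \<not> \<not> e)] []" using k by (rule braid_eq.cancel)
    then have "braid_eq m (?i @ [(k, \<not> e), (k, e)] @ u) (?i @ [] @ u)"
      by (intro braid_eq.congr) (use Cons i in auto)
    then show ?case using i k x braid_eq.trans by fastforce
  qed
  then show "\<exists>V\<in>carrier (braid_group m). V \<otimes>\<^bsub>braid_group m\<^esub> U = \<one>\<^bsub>braid_group m\<^esub>"
    using u by (intro bexI[of _ "braid_class m v"])
      (auto simp: car one braid_mult_class braid_class_eq)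
  fix V assume "V \<in> carrier (braid_group m)"
  then obtain v where v: "v \<in> braid_words m" "V = braid_class m v" by (auto simp: car)
  show "U \<otimes>\<^bsub>braid_group m\<^esub> V \<in> carrier (braid_group m)"
    using u v by (auto simp: car braid_mult_class)
  fix W assume "W \<in> carrier (braid_group m)"
  then obtain w where w: "w \<in> braid_words m" "W = braid_class m w" by (auto simp: car)
  show "U \<otimes>\<^bsub>braid_group m\<^esub> V \<otimes>\<^bsub>braid_group m\<^esub> W = U \<otimes>\<^bsub>braid_group m\<^esub> (V \<otimes>\<^bsub>braid_group m\<^esub> W)"
    using u v w by (simp add: braid_mult_class)
qed

lemma braid_act_class:
  assumes "w \<in> braid_words (n - 1)"
  shows "braid_act n (braid_class (n - 1) w) = (\<lambda>X\<in>Pi_space n. foldr (letter_act n) w X)"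
proof -
  have "(SOME v. v \<in> braid_class (n - 1) w) \<in> braid_class (n - 1) w"
    by (rule someI) (rule braid_class_self[OF assms])
  then have "braid_eq (n - 1) w (SOME v. v \<in> braid_class (n - 1) w)"
    by (simp add: braid_class_def)
  then show ?thesis unfolding braid_act_def
    by (intro restrict_ext) (metis braid_eq_act)
qed

lemma group_action_braid: "group_action (braid_group (n - 1)) (Pi_space n) (braid_act n)"
proof -
  have car: "carrier (braid_group (n - 1)) = braid_class (n - 1) ` braid_words (n - 1)"
    by (simp add: braid_group_def)
  have Bij: "braid_act n (braid_class (n - 1) w) \<in> Bij (Pi_space n)"
    if "w \<in> braid_words (n - 1)" for w
    unfolding Bij_def braid_act_class[OF that] using word_act_bij[OF that]
    by (simp cong: bij_betw_cong)
  have "braid_act n \<in> hom (braid_group (n - 1)) (BijGroup (Pi_space n))"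
  proof (rule homI)
    fix U assume "U \<in> carrier (braid_group (n - 1))"
    then obtain u where u: "u \<in> braid_words (n - 1)" "U = braid_class (n - 1) u" unfolding car by blast
    then show "braid_act n U \<in> carrier (BijGroup (Pi_space n))" using Bij by (simp add: BijGroup_def del: One_nat_def)
    fix V assume "V \<in> carrier (braid_group (n - 1))"
    then obtain v where v: "v \<in> braid_words (n - 1)" "V = braid_class (n - 1) v" unfolding car by blast
    have "braid_act n (U \<otimes>\<^bsub>braid_group (n - 1)\<^esub> V) = compose (Pi_space n) (braid_act n U) (braid_act n V)"
      using u v by (simp add: braid_mult_class braid_act_class compose_def fun_eq_iff word_act_in
        del: One_nat_def)
    then show "braid_act n (U \<otimes>\<^bsub>braid_group (n - 1)\<^esub> V) =
        braid_act n U \<otimes>\<^bsub>BijGroup (Pi_space n)\<^esub> braid_act n V"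
      using u v Bij by (simp add: BijGroup_def del: One_nat_def)
  qed
  then show ?thesis
    by (simp add: group_action_def group_hom_def group_hom_axioms_def group_braid_group group_BijGroup)
qed

end

theory Submission
  imports Defs
begin

text \<open>The spectral form is polarised by \<open>det (A + B) = 2 + 2 \<langle>A, B\<rangle>\<close>, where \<open>\<langle>\<cdot>, \<cdot>\<rangle>\<close> is the
  Euclidean inner product on \<open>SU(2) = S\<^sup>3\<close>. Its entries are therefore inner products, invariant
  under left and right translation. In the frame where \<open>c\<^sub>k = diag(e\<^sup>i\<^sup>\<phi>, e\<^sup>-\<^sup>i\<^sup>\<phi>)\<close>, conjugation by
  \<open>c\<^sub>k\<close> rotates the upper right entry \<open>b\<close> of \<open>c\<^sub>k\<^sub>+\<^sub>1\<close> by \<open>2\<phi>\<close>. With \<open>b'\<close> that of \<open>c\<^sub>j\<close> and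
  \<open>z = b cnj b'\<close>, the new entry is
  \<open>h - 2 sin\<^sup>2 \<phi> Re z - 2 cos \<phi> sin \<phi> Im z\<close>, and the two determinants
  are the Gram determinants \<open>sin\<^sup>2 \<phi> Re z\<close> and \<open>(sin \<phi> Im z)\<^sup>2\<close>. As \<open>sin \<phi> \<ge> 0\<close>, the sign
  of the root is that of \<open>Im z\<close>.\<close>

section \<open>Determinants and the inner product on SU(2)\<close>

text \<open>Cofactor expansion along the first row, needed to turn the larger Gram determinant into
  a polynomial. Permutations of the four indices are built by inserting one index at a time.\<close>

lemma det_4:
  fixes A :: "'a::comm_ring_1^4^4"
  shows "det A =
    A$1$1 * (A$2$2 * (A$3$3 * A$4$4 - A$3$4 * A$4$3) - A$2$3 * (A$3$2 * A$4$4 - A$3$4 * A$4$2)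
      + A$2$4 * (A$3$2 * A$4$3 - A$3$3 * A$4$2))
    - A$1$2 * (A$2$1 * (A$3$3 * A$4$4 - A$3$4 * A$4$3) - A$2$3 * (A$3$1 * A$4$4 - A$3$4 * A$4$1)
      + A$2$4 * (A$3$1 * A$4$3 - A$3$3 * A$4$1))
    + A$1$3 * (A$2$1 * (A$3$2 * A$4$4 - A$3$4 * A$4$2) - A$2$2 * (A$3$1 * A$4$4 - A$3$4 * A$4$1)
      + A$2$4 * (A$3$1 * A$4$2 - A$3$2 * A$4$1))
    - A$1$4 * (A$2$1 * (A$3$2 * A$4$3 - A$3$3 * A$4$2) - A$2$2 * (A$3$1 * A$4$3 - A$3$3 * A$4$1)
      + A$2$3 * (A$3$1 * A$4$2 - A$3$2 * A$4$1))"
proof -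
  have f1: "finite {2::4, 3, 4}" "1 \<notin> {2::4, 3, 4}"
    and f2: "finite {3::4, 4}" "2 \<notin> {3::4, 4}"
    and f3: "finite {4::4}" "3 \<notin> {4::4}"
    by auto
  show ?thesis
    unfolding det_def UNIV_4
    unfolding sum_over_permutations_insert[OF f1]
    unfolding sum_over_permutations_insert[OF f2]
    unfolding sum_over_permutations_insert[OF f3]
    unfolding permutes_sing
    by (simp add: sign_swap_id permutation_swap_id sign_compose sign_id swap_id_eq
        permutation_compose algebra_simps)
qed

text \<open>The first row determines a matrix of SU(2) and is a unit vector of C^2 = R^4, so it
  suffices for the inner product.\<close>

definition su2_inner :: "complex^2^2 \<Rightarrow> complex^2^2 \<Rightarrow> real" where
  "su2_inner A B = Re (A$1$1 * cnj (B$1$1) + A$1$2 * cnj (B$1$2))"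

lemma det_add_SU2:
  assumes "A \<in> SU2" "B \<in> SU2"
  shows "det (A + B) = complex_of_real (2 + 2 * su2_inner A B)"
proof -
  have "det A = 1" "det B = 1" using assms by (simp_all add: SU2_def)
  then have "det (A + B) = 2 + (A$1$1 * B$2$2 + B$1$1 * A$2$2 - A$1$2 * B$2$1 - B$1$2 * A$2$1)"
    by (simp add: det_2 algebra_simps)
  then show ?thesis
    by (simp add: SU2_entries(1,2)[OF assms(1)] SU2_entries(1,2)[OF assms(2)] su2_inner_def
        complex_eq_iff algebra_simps)
qed

text \<open>Factors of determinant 1 leave \<open>det (A + B)\<close> unchanged, and by
  \<open>det_add_SU2\<close> this determinant determines the inner product.\<close>

lemma su2_inner_translate:
  assumes "A \<in> SU2" "B \<in> SU2" "h \<in> SU2" "q \<in> SU2"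
  shows "su2_inner (h ** A ** q) (h ** B ** q) = su2_inner A B"
proof -
  have "h ** A ** q + h ** B ** q = h ** (A + B) ** q"
    by (simp add: matrix_add_ldistrib mat2_add_rdistrib)
  then have "det (h ** A ** q + h ** B ** q) = det (A + B)"
    using assms by (simp add: det_mul SU2_def)
  then have "complex_of_real (2 + 2 * su2_inner (h ** A ** q) (h ** B ** q)) =
      complex_of_real (2 + 2 * su2_inner A B)"
    using assms by (simp only: det_add_SU2 SU2_mult)
  then show ?thesis unfolding of_real_eq_iff by simp
qed

lemma form_matrix_entry:
  assumes A: "is_form_matrix n (spectral_form n c) A" and ij: "i < n" "j < n"
    and "c i \<in> SU2" "c j \<in> SU2" "A i i = 1" "A j j = 1"
  shows "A i j = su2_inner (c i) (c j)"
proof -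
  \<comment> \<open>At this sum of two unit vectors the form is \<open>det (c i + c j)\<close>; with
    diagonal entries 1, only \<open>A i j\<close> is left to solve for.\<close>
  let ?l = "\<lambda>x. of_bool (x = i) + of_bool (x = j) :: real"
  have "(\<Sum>x<n. ?l x *\<^sub>R c x) = c i + c j"
    using ij by (simp add: scaleR_add_left sum.distrib of_bool_def if_distrib[of "\<lambda>t. t *\<^sub>R _"] cong: if_cong)
  then have "det (c i + c j) = spectral_form n c ?l" by (simp add: spectral_form_def)
  also have "\<dots> = complex_of_real (\<Sum>x<n. \<Sum>y<n. A x y * ?l x * ?l y)"
    using A by (simp only: is_form_matrix_def)
  also have "(\<Sum>x<n. \<Sum>y<n. A x y * ?l x * ?l y) = A i i + A i j + A j i + A j j"
    using ij by (simp only: distrib_left distrib_right sum.distrib quadratic_form_eval)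
  also have "A j i = A i j" using A ij by (simp add: is_form_matrix_def)
  finally have "complex_of_real (2 + 2 * su2_inner (c i) (c j)) = complex_of_real (2 + 2 * A i j)"
    using assms by (simp add: det_add_SU2)
  then show ?thesis unfolding of_real_eq_iff by simp
qed

section \<open>Diagonalisation in SU(2)\<close>

lemma vector_in_SU2:
  fixes u v :: complex
  assumes "(cmod u)\<^sup>2 + (cmod v)\<^sup>2 = 1"
  shows "vector [vector [u, v], vector [- cnj v, cnj u]] \<in> SU2" (is "?A \<in> SU2")
proof -
  have *: "u * cnj u + v * cnj v = 1"
    using assms by (metis complex_norm_square of_real_1 of_real_add)
  then have "adj ?A ** ?A = mat 1" "det ?A = 1"
    by (simp_all add: mat2_eq_iff adj_def matrix_matrix_mult_def sum_2 mat_def det_2 algebra_simps)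
  then show ?thesis by (simp add: SU2_def)
qed

text \<open>Half the trace, \<open>Re a\<close>, lies in [-1, 1] and so equals
  \<open>cos \<phi>\<close> for some \<open>\<phi>\<close> in [0, pi]. A unit left eigenvector for
  \<open>cis \<phi>\<close> serves as the first row of \<open>u\<close>.\<close>

lemma diagonalises_exists:
  assumes "c \<in> SU2"
  shows "\<exists>u \<phi>. diagonalises u \<phi> c"
proof -
  define a b where "a = c$1$1" and "b = c$1$2"
  have c: "c$1$1 = a" "c$1$2 = b" "c$2$1 = - cnj b" "c$2$2 = cnj a"
    using SU2_entries[OF assms] by (simp_all add: a_def b_def)
  have ab: "(cmod a)\<^sup>2 + (cmod b)\<^sup>2 = 1" using SU2_entries(3)[OF assms] by (simp add: a_def b_def)
  then have "(Re a)\<^sup>2 \<le> 1" by (simp add: cmod_power2) (smt (verit) zero_le_power2)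
  then have Re: "\<bar>Re a\<bar> \<le> 1" by (simp add: abs_square_le_1)
  define \<phi> where "\<phi> = arccos (Re a)"
  have \<phi>: "0 \<le> \<phi>" "\<phi> \<le> pi" "cos \<phi> = Re a"
    using Re by (auto simp: \<phi>_def arccos_lbound arccos_ubound cos_arccos_abs)
  define e where "e = cis \<phi>"
  have e: "cis (- \<phi>) = cnj e" "e * cnj e = 1" "e + cnj e = a + cnj a"
    using \<phi> sin_cos_squared_add2[of \<phi>] by (simp_all add: e_def cis_cnj complex_eq_iff power2_eq_square)
  have "\<exists>u\<in>SU2. u ** c = vector [vector [e, 0], vector [0, cnj e]] ** u"
  \<comment> \<open>Exactly here the candidate eigenvector \<open>(cnj b, a - e)\<close> vanishes,
    but \<open>c\<close> already has the required diagonal form. If \<open>b = 0\<close> and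
    \<open>a = cnj e\<close>, the other case exchanges the two diagonal entries.\<close>
  proof (cases "b = 0 \<and> a = e")
    case True
    then have "mat 1 ** c = vector [vector [e, 0], vector [0, cnj e]] ** mat 1"
      by (simp add: mat2_eq_iff c)
    then show ?thesis using SU2_one by blast
  next
    case False
    define N where "N = sqrt ((cmod b)\<^sup>2 + (cmod (a - e))\<^sup>2)"
    have N: "N > 0" using False by (auto simp: N_def add_pos_nonneg add_nonneg_pos)
    \<comment> \<open>\<open>(x, y)\<close> is a unit left eigenvector of \<open>c\<close> for the eigenvalue \<open>e\<close>.\<close>
    define x y where "x = cnj b / N" and "y = (a - e) / N"
    have "(cmod x)\<^sup>2 + (cmod y)\<^sup>2 = ((cmod b)\<^sup>2 + (cmod (a - e))\<^sup>2) / N\<^sup>2"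
      using N by (simp add: x_def y_def norm_divide power_divide add_divide_distrib)
    also have "\<dots> = 1" using N False by (simp add: N_def)
    finally have xy: "vector [vector [x, y], vector [- cnj y, cnj x]] \<in> SU2" (is "?u \<in> _")
      by (rule vector_in_SU2)
    have ab': "a * cnj a + b * cnj b = 1"
      using ab by (metis complex_norm_square of_real_1 of_real_add)
    have 1: "x * a - y * cnj b = e * x" by (simp add: x_def y_def diff_divide_distrib algebra_simps)
    \<comment> \<open>The right side is the characteristic polynomial of \<open>c\<close> at
      \<open>e\<close>; it vanishes because \<open>e\<close> and \<open>cnj e\<close> have the same
      sum and product as the eigenvalues.\<close>
    have "b * cnj b + (a - e) * cnj a - e * (a - e) = (a * cnj a + b * cnj b) - e * (a + cnj a) + e * e"
      by (simp add: algebra_simps)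
    also have "\<dots> = 0" using e(2) by (simp add: ab' e(3)[symmetric] algebra_simps)
    finally have 2: "x * b + y * cnj a = e * y"
      using N by (simp add: x_def y_def field_simps)
    \<comment> \<open>Conjugation yields the second row of \<open>u\<close>, a left eigenvector for
      \<open>cnj e\<close>.\<close>
    have "cnj x * cnj a - cnj y * b = cnj e * cnj x" "cnj x * cnj b + cnj y * a = cnj e * cnj y"
      using arg_cong[OF 1, of cnj] arg_cong[OF 2, of cnj] by simp_all
    with 1 2 have "?u ** c = vector [vector [e, 0], vector [0, cnj e]] ** ?u"
      by (simp add: mat2_eq_iff matrix_matrix_mult_def sum_2 c algebra_simps)
    then show ?thesis using xy by blast
  qed
  then obtain u where u: "u \<in> SU2" "u ** c = vector [vector [e, 0], vector [0, cnj e]] ** u" by blast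
  then have "diagonalises u \<phi> c"
    using \<phi> by (simp add: diagonalises_def e(1) e_def[symmetric])
  then show ?thesis by blast
qed

section \<open>Gram determinants in the diagonal frame\<close>

text \<open>\<open>mat 1\<close> and \<open>A\<close> lie in the plane of diagonal matrices and have
  Gram determinant \<open>(sin \<phi>)\<^sup>2\<close>; the orthogonal parts of \<open>x\<close> and
  \<open>y\<close> are their upper right entries. Hence each determinant is
  \<open>(sin \<phi>)\<^sup>2\<close> times one for these entries: their inner product
  \<open>Re z\<close>, or their own Gram determinant \<open>(Im z)\<^sup>2\<close>.\<close>

lemma diagonal_gram_identities:
  fixes x y A B :: "complex^2^2"
  assumes A: "A = vector [vector [cis \<phi>, 0], vector [0, cis (- \<phi>)]]"
    and x: "x \<in> SU2" and y: "y \<in> SU2"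
  defines "z \<equiv> x$1$2 * cnj (y$1$2)"
  shows "det (vector [
      vector [1, su2_inner (mat 1) A, su2_inner (mat 1) x],
      vector [su2_inner (mat 1) A, 1, su2_inner A x],
      vector [su2_inner (mat 1) y, su2_inner A y, su2_inner x y]] :: real^3^3) = (sin \<phi>)\<^sup>2 * Re z"
    and "det (vector [
      vector [1, su2_inner (mat 1) A, su2_inner (mat 1) x, su2_inner (mat 1) y],
      vector [su2_inner (mat 1) A, 1, su2_inner A x, su2_inner A y],
      vector [su2_inner (mat 1) x, su2_inner A x, 1, su2_inner x y],
      vector [su2_inner (mat 1) y, su2_inner A y, su2_inner x y, 1]] :: real^4^4) = (sin \<phi> * Im z)\<^sup>2"
    and "su2_inner (A ** x ** matrix_inv A) y =
      su2_inner x y - 2 * ((sin \<phi>)\<^sup>2 * Re z) - 2 * cos \<phi> * (sin \<phi> * Im z)"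
proof -
  define X Y S T where "X = Re (x$1$1)" and "Y = Im (x$1$1)" and "S = Re (x$1$2)" and "T = Im (x$1$2)"
  define X' Y' S' T' where "X' = Re (y$1$1)" and "Y' = Im (y$1$1)" and "S' = Re (y$1$2)" and "T' = Im (y$1$2)"
  note xy = X_def[symmetric] Y_def[symmetric] S_def[symmetric] T_def[symmetric]
    X'_def[symmetric] Y'_def[symmetric] S'_def[symmetric] T'_def[symmetric]
  define C s where "C = cos \<phi>" and "s = sin \<phi>"
  have cs: "C * C = 1 - s * s" using sin_cos_squared_add[of \<phi>] by (simp add: C_def s_def power2_eq_square)
  \<comment> \<open>These account for the last two diagonal entries 1 of the larger matrix, which
    stand for the squared norms of \<open>x\<close> and \<open>y\<close>.\<close>
  have nx: "1 = X * X + Y * Y + S * S + T * T" and ny: "1 = X' * X' + Y' * Y' + S' * S' + T' * T'"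
    using SU2_entries(3)[OF x] SU2_entries(3)[OF y] unfolding cmod_power2 xy by (simp_all add: power2_eq_square)
  have i: "su2_inner (mat 1) A = C" "su2_inner (mat 1) x = X" "su2_inner (mat 1) y = X'"
    "su2_inner A x = C * X + s * Y" "su2_inner A y = C * X' + s * Y'"
    "su2_inner x y = X * X' + Y * Y' + S * S' + T * T'"
    by (simp_all add: su2_inner_def A mat_def xy C_def s_def)
  have z: "Re z = S * S' + T * T'" "Im z = T * S' - S * T'" by (simp_all add: z_def xy)
  show "det (vector [
      vector [1, su2_inner (mat 1) A, su2_inner (mat 1) x],
      vector [su2_inner (mat 1) A, 1, su2_inner A x],
      vector [su2_inner (mat 1) y, su2_inner A y, su2_inner x y]] :: real^3^3) = (sin \<phi>)\<^sup>2 * Re z"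
    unfolding det_3 vector_3 i z C_def[symmetric] s_def[symmetric] using cs by algebra
  show "det (vector [
      vector [1, su2_inner (mat 1) A, su2_inner (mat 1) x, su2_inner (mat 1) y],
      vector [su2_inner (mat 1) A, 1, su2_inner A x, su2_inner A y],
      vector [su2_inner (mat 1) x, su2_inner A x, 1, su2_inner x y],
      vector [su2_inner (mat 1) y, su2_inner A y, su2_inner x y, 1]] :: real^4^4) = (sin \<phi> * Im z)\<^sup>2"
    unfolding det_4 vector_4 i z C_def[symmetric] s_def[symmetric] using cs nx ny by algebra
  have "vector [vector [cis \<phi>, 0], vector [- cnj 0, cnj (cis \<phi>)]] \<in> SU2"
    by (rule vector_in_SU2) simp
  then have "A \<in> SU2" by (simp add: A cis_cnj)
  then have "matrix_inv A = vector [vector [cis (- \<phi>), 0], vector [0, cis \<phi>]]"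
    by (simp add: SU2_inv_eq A adj_def mat2_eq_iff cis_cnj)
  then have "(A ** x ** matrix_inv A) $ 1 $ 1 = x$1$1"
    "(A ** x ** matrix_inv A) $ 1 $ 2 = cis \<phi> * cis \<phi> * x$1$2"
    by (simp_all add: A matrix_matrix_mult_def sum_2 cis_mult algebra_simps)
  then have "su2_inner (A ** x ** matrix_inv A) y =
      X * X' + Y * Y' + ((C * C - s * s) * S - 2 * C * s * T) * S' + ((C * C - s * s) * T + 2 * C * s * S) * T'"
    by (simp add: su2_inner_def xy C_def s_def algebra_simps)
  then show "su2_inner (A ** x ** matrix_inv A) y =
      su2_inner x y - 2 * ((sin \<phi>)\<^sup>2 * Re z) - 2 * cos \<phi> * (sin \<phi> * Im z)"
    unfolding i z C_def[symmetric] s_def[symmetric] using cs by algebra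
qed

section \<open>The action of a braid generator on the form matrix\<close>

text \<open>The first conjunct ties \<open>braid_move\<close> to the braid group action. The branch
  of the root is a real \<open>r\<close> fixed by its square and its sign; the existence of
  \<open>u\<close> and \<open>\<phi>\<close> keeps the clause about all of them from being
  vacuous.\<close>

theorem mainTheorem6:
  fixes n k :: nat
    and X :: "(nat \<Rightarrow> complex^2^2) set"
    and c :: "nat \<Rightarrow> complex^2^2"
    and p p' :: "nat \<Rightarrow> real"
    and h h' :: "nat \<Rightarrow> nat \<Rightarrow> real"
  assumes "n \<ge> 3" and "1 \<le> k" and "k \<le> n - 2"
    and "X \<in> Pi_space n" and "c \<in> X" and "c 0 = mat 1"
    and "\<And>i j. h i j = h j i" and "\<And>i j. h' i j = h' j i"
    and "is_form_matrix n (spectral_form n c) (bordered_matrix p h)"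
    and "is_form_matrix n (spectral_form n (braid_move k c)) (bordered_matrix p' h')"
  shows
    "braid_move k c \<in> braid_act n (braid_sigma (n - 1) k) X \<and>
     (\<forall>i\<in>{1..n - 1} - {k, k + 1}. \<forall>j\<in>{1..n - 1} - {k, k + 1}. i \<noteq> j \<longrightarrow> h' i j = h i j) \<and>
     (\<forall>i\<in>{1..n - 1} - {k, k + 1}. p' i = p i) \<and>
     p' k = p (k + 1) \<and>
     p' (k + 1) = p k \<and>
     (\<forall>j\<in>{1..n - 1} - {k, k + 1}. h' (k + 1) j = h k j) \<and>
     (\<exists>u \<phi>. diagonalises u \<phi> (c k)) \<and>
     (\<forall>u \<phi>. diagonalises u \<phi> (c k) \<longrightarrow>
       (\<forall>j\<in>{1..n - 1} - {k, k + 1}.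
         let b = (\<lambda>i. (u ** c i ** matrix_inv u) $ 1 $ 2) in
         \<exists>r::real.
           r\<^sup>2 = det (vector [
                 vector [1,         p k,         p (k + 1),   p j],
                 vector [p k,       1,           h k (k + 1), h k j],
                 vector [p (k + 1), h k (k + 1), 1,           h (k + 1) j],
                 vector [p j,       h k j,       h (k + 1) j, 1]] :: real^4^4) \<and>
           (if Im (b (k + 1) * cnj (b j)) \<ge> 0 then r \<ge> 0 else r \<le> 0) \<and>
           h' k j = h (k + 1) j
             - 2 * det (vector [
                 vector [1,   p k,   p (k + 1)],
                 vector [p k, 1,     h k (k + 1)],
                 vector [p j, h k j, h (k + 1) j]] :: real^3^3)
             - 2 * p k * r))"
proof -
  have kn: "0 < n" "k < n" "Suc k < n" "k \<noteq> 0" using assms(1-3) by auto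
  have ct: "c \<in> su2_tuples n" and X: "X = pi_class n c"
    using pi_space_class[OF assms(4,5)] by blast+
  have mem: "c i \<in> SU2" if "i < n" for i using ct that by (auto simp: su2_tuples_def)
  define d where "d = braid_move k c"
  have dt: "d \<in> su2_tuples n" using braid_move_tuple[OF ct kn(3)] by (simp add: d_def)
  have memd: "d i \<in> SU2" if "i < n" for i using dt that by (auto simp: su2_tuples_def)
  have d: "d 0 = mat 1" "d k = c k ** c (Suc k) ** matrix_inv (c k)" "d (Suc k) = c k"
    "\<And>i. i \<noteq> k \<Longrightarrow> i \<noteq> Suc k \<Longrightarrow> d i = c i"
    using kn assms(6) by (simp_all add: d_def braid_move_def)
  have p: "p i = su2_inner (mat 1) (c i)" if "0 < i" "i < n" for i
    using form_matrix_entry[OF assms(9) kn(1) that(2)] mem that assms(6)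
    by (auto simp: bordered_matrix_def SU2_one)
  have h: "h i j = su2_inner (c i) (c j)" if "0 < i" "i < n" "0 < j" "j < n" "i \<noteq> j" for i j
    using form_matrix_entry[OF assms(9) that(2,4)] mem that by (auto simp: bordered_matrix_def)
  have p': "p' i = su2_inner (mat 1) (d i)" if "0 < i" "i < n" for i
    using form_matrix_entry[OF assms(10)[folded d_def] kn(1) that(2)] memd that d(1)
    by (auto simp: bordered_matrix_def SU2_one)
  have h': "h' i j = su2_inner (d i) (d j)" if "0 < i" "i < n" "0 < j" "j < n" "i \<noteq> j" for i j
    using form_matrix_entry[OF assms(10)[folded d_def] that(2,4)] memd that
    by (auto simp: bordered_matrix_def)
  have conj: "su2_inner (u ** A ** matrix_inv u) (u ** B ** matrix_inv u) = su2_inner A B"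
    if "u \<in> SU2" "A \<in> SU2" "B \<in> SU2" for u A B
    using that by (simp add: su2_inner_translate SU2_inv)
  have J: "0 < j" "j < n" "j \<noteq> k" "j \<noteq> Suc k" if "j \<in> {1..n - 1} - {k, k + 1}" for j
    using that by auto
  have act: "braid_move k c \<in> braid_act n (braid_sigma (n - 1) k) X"
  proof -
    have "[(k, True)] \<in> braid_words (n - 1)" using kn by auto
    then have "braid_act n (braid_sigma (n - 1) k) X = pi_class n (braid_move k c)"
      using assms(4) sigma_act_class[OF ct assms(6) kn(3)]
      by (simp add: braid_sigma_def braid_act_class letter_act_def X del: One_nat_def)
    then show ?thesis using pi_class_self[OF dt] by (simp add: d_def)
  qed
  \<comment> \<open>Conjugation by \<open>c k\<close> fixes \<open>mat 1\<close>, so the inner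
    product with \<open>mat 1\<close> is preserved.\<close>
  have pk: "p' k = p (k + 1)"
    using conj[of "c k" "mat 1" "c (Suc k)"] kn mem by (simp add: p p' d SU2_one)
  have formula: "\<exists>r::real.
           r\<^sup>2 = det (vector [
                 vector [1,         p k,         p (k + 1),   p j],
                 vector [p k,       1,           h k (k + 1), h k j],
                 vector [p (k + 1), h k (k + 1), 1,           h (k + 1) j],
                 vector [p j,       h k j,       h (k + 1) j, 1]] :: real^4^4) \<and>
           (if Im (b (k + 1) * cnj (b j)) \<ge> 0 then r \<ge> 0 else r \<le> 0) \<and>
           h' k j = h (k + 1) j
             - 2 * det (vector [
                 vector [1,   p k,   p (k + 1)],
                 vector [p k, 1,     h k (k + 1)],
                 vector [p j, h k j, h (k + 1) j]] :: real^3^3)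
             - 2 * p k * r"
    if diag: "diagonalises u \<phi> (c k)" and j: "j \<in> {1..n - 1} - {k, k + 1}"
      and b: "b = (\<lambda>i. (u ** c i ** matrix_inv u) $ 1 $ 2)" for u \<phi> j b
  proof -
    \<comment> \<open>The whole tuple is moved to the diagonal frame; by \<open>conj\<close> the
      entries \<open>p\<close> and \<open>h\<close> can be read off there.\<close>
    define C where "C i = u ** c i ** matrix_inv u" for i
    have u: "u \<in> SU2" "matrix_inv u \<in> SU2" and \<phi>: "0 \<le> \<phi>" "\<phi> \<le> pi"
      and Ck: "C k = vector [vector [cis \<phi>, 0], vector [0, cis (- \<phi>)]]"
      using diag by (auto simp: diagonalises_def C_def SU2_inv)
    note j = J[OF j]
    have Cm: "C i \<in> SU2" if "i < n" for i using u mem[OF that] by (simp add: C_def SU2_mult)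
    have pC: "p i = su2_inner (mat 1) (C i)" if "0 < i" "i < n" for i
      using conj[OF u(1) SU2_one mem[OF that(2)]] u p[OF that] by (simp add: C_def)
    have hC: "h i l = su2_inner (C i) (C l)" if "0 < i" "i < n" "0 < l" "l < n" "i \<noteq> l" for i l
      using conj[OF u(1) mem[OF that(2)] mem[OF that(4)]] h[OF that] by (simp add: C_def)
    have "u ** d k ** matrix_inv u = C k ** C (Suc k) ** matrix_inv (C k)"
      using u kn mem by (simp add: d C_def SU2_inv_mult SU2_mult SU2_inv matrix_mul_assoc)
    then have h'k: "h' k j = su2_inner (C k ** C (Suc k) ** matrix_inv (C k)) (C j)"
      using conj[OF u(1) memd[of k] memd[of j]] h'[of k j] kn j by (simp add: C_def d(4))
    have pk: "p k = cos \<phi>" using kn by (simp add: pC Ck su2_inner_def mat_def)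
    define z where "z = C (Suc k) $ 1 $ 2 * cnj (C j $ 1 $ 2)"
    note gram = diagonal_gram_identities[OF Ck Cm[of "Suc k"] Cm[of j], folded z_def]
    have sgn: "if Im z \<ge> 0 then sin \<phi> * Im z \<ge> 0 else sin \<phi> * Im z \<le> 0"
      using sin_ge_zero[OF \<phi>] by (auto simp: mult_nonneg_nonpos)
    show ?thesis
    \<comment> \<open>This witness is the root with its sign built in, and
      \<open>p k = cos \<phi>\<close> supplies the factor in front of it.\<close>
    proof (intro exI[of _ "sin \<phi> * Im z"] conjI)
      show "(sin \<phi> * Im z)\<^sup>2 = det (vector [
                 vector [1,         p k,         p (k + 1),   p j],
                 vector [p k,       1,           h k (k + 1), h k j],
                 vector [p (k + 1), h k (k + 1), 1,           h (k + 1) j],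
                 vector [p j,       h k j,       h (k + 1) j, 1]] :: real^4^4)"
        using gram(2) kn j by (simp add: pC hC)
      show "if Im (b (k + 1) * cnj (b j)) \<ge> 0 then sin \<phi> * Im z \<ge> 0 else sin \<phi> * Im z \<le> 0"
        using sgn by (simp add: b z_def C_def)
      show "h' k j = h (k + 1) j
             - 2 * det (vector [
                 vector [1,   p k,   p (k + 1)],
                 vector [p k, 1,     h k (k + 1)],
                 vector [p j, h k j, h (k + 1) j]] :: real^3^3)
             - 2 * p k * (sin \<phi> * Im z)"
        using gram(1,3) kn j h'k pk
        by (simp add: pC hC)
    qed
  qed
  show ?thesis
  proof (intro conjI ballI impI allI)
    show "p' (k + 1) = p k" "p' k = p (k + 1)" using kn pk by (simp_all add: p p' d)
    show "\<exists>u \<phi>. diagonalises u \<phi> (c k)" using diagonalises_exists mem kn by blast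
    show "braid_move k c \<in> braid_act n (braid_sigma (n - 1) k) X" by (rule act)
  next
    fix i assume i: "i \<in> {1..n - 1} - {k, k + 1}"
    show "p' i = p i" using J[OF i] by (simp add: p p' d)
    show "h' (k + 1) i = h k i" using J[OF i] kn by (simp add: h h' d)
    fix j assume j: "j \<in> {1..n - 1} - {k, k + 1}" and "i \<noteq> j"
    then show "h' i j = h i j" using J[OF i] J[OF j] by (simp add: h h' d)
  next
    fix u \<phi> j
    assume "diagonalises u \<phi> (c k)" "j \<in> {1..n - 1} - {k, k + 1}"
    from formula[OF this HOL.refl] show "let b = (\<lambda>i. (u ** c i ** matrix_inv u) $ 1 $ 2) in
         \<exists>r::real.
           r\<^sup>2 = det (vector [
                 vector [1,         p k,         p (k + 1),   p j],
                 vector [p k,       1,           h k (k + 1), h k j],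
                 vector [p (k + 1), h k (k + 1), 1,           h (k + 1) j],
                 vector [p j,       h k j,       h (k + 1) j, 1]] :: real^4^4) \<and>
           (if Im (b (k + 1) * cnj (b j)) \<ge> 0 then r \<ge> 0 else r \<le> 0) \<and>
           h' k j = h (k + 1) j
             - 2 * det (vector [
                 vector [1,   p k,   p (k + 1)],
                 vector [p k, 1,     h k (k + 1)],
                 vector [p j, h k j, h (k + 1) j]] :: real^3^3)
             - 2 * p k * r"
      unfolding Let_def .
  qed
qed

end
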